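(* Let $M\ge 4$ be an integer and let $\mathcal{S}=\{n_j\}_{j\ge1}$ be a sequence of positive integers satisfying $n_{j+M}>2n_j$ for all $j\ge 1$. Let $c_0$ be a real number with $240c_0\le 1$, and for $j\ge 1$ define $$E_j=\Big\{\theta\in\mathbb{T}: \|n_j\theta\|<\frac{c_0}{M\log_2 M}\Big\}.$$ Then $\bigcap_{j=1}^\infty E_j^c\neq\emptyset$.
   Context: $\mathbb{T}=[0,1)$ denotes the circle $\mathbb{R}/\mathbb{Z}$, and $E_j^c$ is the complement of $E_j$ in $\mathbb{T}$. For a real number $t$, $\|t\|$ denotes the distance from $t$ to the nearest integer. *)

theory Defs
  imports "HOL-Analysis.Analysis"
begin

definition circle :: "real set" where
  "circle = {0..<1}"

definition dist_nearest_int :: "real \<Rightarrow> real" where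
  "dist_nearest_int t = dist t (of_int (round t))"

definition E :: "nat \<Rightarrow> real \<Rightarrow> (nat \<Rightarrow> nat) \<Rightarrow> nat \<Rightarrow> real set" where
  "E M c\<^sub>0 n j = {\<theta> \<in> circle. dist_nearest_int (real (n j) * \<theta>) < c\<^sub>0 / (real M * log 2 (real M))}"

end

theory Submission
  imports Defs
begin

text \<open>
  Call a number \<open>v\<close> of scale \<open>k\<close> if \<open>2\<^sup>k \<le> v < 2\<^sup>k\<^sup>+\<^sup>1\<close>; by lacunarity there are at most \<open>M\<close> indices
  of each scale. Subdivide \<open>[0, 4)\<close> dyadically and let the numbers of scale \<open>k\<close> delete, at level
  \<open>k + s\<close> (where \<open>2\<^sup>s\<close> is about \<open>M\<^sup>8\<close>), the cells that contain a point with \<open>\<parallel>v\<theta>\<parallel> < \<delta> = 1 / (30 M s)\<close>. A cell of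
  level \<open>k\<close> has length at least \<open>4 / v\<close>, so these deletions are evenly spread over it
  and hit at most a proportion \<open>1 / (4 s)\<close> of its descendants. As in the one-sided local
  lemma, comparing the survivors at level \<open>k + s\<close> with those at level \<open>k\<close> shows that their number
  grows by a factor of at least \<open>2 - 1 / s\<close> at each level, hence never vanishes. Compactness and
  reduction modulo \<open>1\<close> give the point.
\<close>

section \<open>Counting survivors in a dyadic tree\<close>

text \<open>The integer \<open>a\<close> at level \<open>t\<close> stands for the cell
  \<open>[4a / 2^t, 4(a+1) / 2^t]\<close>, whose parent is \<open>a div 2\<close>. Keeping
  \<open>bad\<close> arbitrary separates the counting from the geometry.\<close>

fun survivors :: "(nat \<Rightarrow> int \<Rightarrow> bool) \<Rightarrow> nat \<Rightarrow> int set" where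
  "survivors bad 0 = {0}"
| "survivors bad (Suc t) = {a. a div 2 \<in> survivors bad t \<and> \<not> bad (Suc t) a}"

lemma card_UN_le_times:
  fixes b :: real
  assumes "finite I" and "\<And>i. i \<in> I \<Longrightarrow> real (card (F i)) \<le> b"
  shows "real (card (\<Union>i\<in>I. F i)) \<le> real (card I) * b"
proof -
  have "real (card (\<Union>i\<in>I. F i)) \<le> real (\<Sum>i\<in>I. card (F i))"
    unfolding of_nat_le_iff by (rule card_UN_le) fact
  also have "\<dots> \<le> real (card I) * b"
    unfolding of_nat_sum by (rule sum_bounded_above) fact
  finally show ?thesis .
qed

lemma children_eq: "{a::int. a div 2 \<in> S} = (\<lambda>a. 2 * a) ` S \<union> (\<lambda>a. 2 * a + 1) ` S"
proof (intro equalityI subsetI)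
  fix a :: int assume "a \<in> {a. a div 2 \<in> S}"
  moreover have "a = 2 * (a div 2) \<or> a = 2 * (a div 2) + 1" by presburger
  ultimately show "a \<in> (\<lambda>a. 2 * a) ` S \<union> (\<lambda>a. 2 * a + 1) ` S" by blast
qed auto

lemma finite_children: "finite S \<Longrightarrow> finite {a::int. a div 2 \<in> S}"
  by (simp add: children_eq)

lemma card_children:
  assumes "finite S" shows "card {a::int. a div 2 \<in> S} = 2 * card S"
proof -
  have "(\<lambda>a::int. 2 * a) ` S \<inter> (\<lambda>a. 2 * a + 1) ` S = {}"
    by (auto, presburger)
  moreover have "inj_on (\<lambda>a::int. 2 * a) S" "inj_on (\<lambda>a::int. 2 * a + 1) S"
    by (auto simp: inj_on_def)
  ultimately show ?thesis
    using assms by (simp add: children_eq card_Un_disjoint card_image)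
qed

lemma finite_survivors: "finite (survivors bad t)"
proof (induction t)
  case (Suc t)
  then show ?case by (auto intro: finite_subset[OF _ finite_children[OF Suc]])
qed simp

lemma survivors_ancestor:
  "a \<in> survivors bad (t + i) \<Longrightarrow> a div 2 ^ i \<in> survivors bad t"
proof (induction i arbitrary: a)
  case (Suc i)
  then have "a div 2 div 2 ^ i \<in> survivors bad t" by simp
  then show ?case by (simp add: zdiv_zmult2_eq)
qed simp

lemma survivors_bounds: "a \<in> survivors bad t \<Longrightarrow> 0 \<le> a \<and> a < 2 ^ t"
proof (induction t arbitrary: a)
  case (Suc t)
  then have "a div 2 \<in> survivors bad t" by simp
  from Suc.IH[OF this] show ?case by simp linarith
qed simp

text \<open>Let \<open>g t\<close> count the survivors. For \<open>t + 1 \<ge> s\<close> put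
  \<open>k = t + 1 - s\<close>: every child lost at level \<open>t + 1\<close> descends from a
  survivor at level \<open>k\<close>, so at most \<open>g k * 2^s / (4 * s)\<close> of the
  \<open>2 * g t\<close> children are lost. Induction from \<open>k\<close> up to \<open>t\<close>
  gives \<open>2^s * g k \<le> 4 * g t\<close>, so the loss is at most
  \<open>g t / s\<close>.\<close>

lemma survivors_growth:
  assumes s: "s \<ge> 1"
    and early: "\<And>t a. bad t a \<Longrightarrow> s \<le> t"
    and fin: "\<And>k A. finite {a. a div 2 ^ s = A \<and> bad (k + s) a}"
    and few: "\<And>k A. real (card {a. a div 2 ^ s = A \<and> bad (k + s) a}) \<le> 2 ^ s / (4 * real s)"
  shows "(2 - 1 / real s) * real (card (survivors bad t)) \<le> real (card (survivors bad (Suc t)))"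
proof (induction t rule: less_induct)
  case (less t)
  let ?g = "\<lambda>t. real (card (survivors bad t))" and ?x = "2 - 1 / real s"
  have x1: "?x \<ge> 1" using s by (simp add: divide_simps)
  have ch: "real (card {a. a div 2 \<in> survivors bad t}) = 2 * ?g t"
    by (simp add: card_children finite_survivors)
  show ?case
  proof (cases "Suc t < s")
    case True
    then have "survivors bad (Suc t) = {a. a div 2 \<in> survivors bad t}"
      using early by force
    then have "?g (Suc t) = 2 * ?g t" using ch by metis
    then show ?thesis using s by (simp add: algebra_simps)
  next
    case False
    then obtain k where k: "Suc t = k + s" by (metis add.commute le_Suc_ex not_less)
    have tk: "t = k + (s - 1)" using k s by simp
    have pow: "?x ^ i * ?g k \<le> ?g (k + i)" if "k + i \<le> t" for i
      using that
    proof (induction i)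
      case (Suc i)
      then have "?x ^ i * ?g k \<le> ?g (k + i)" by simp
      then have "?x * (?x ^ i * ?g k) \<le> ?x * ?g (k + i)"
        using x1 by (intro mult_left_mono) auto
      also have "\<dots> \<le> ?g (Suc (k + i))" using less.IH[of "k + i"] Suc.prems by simp
      finally show ?case by (simp add: mult.assoc)
    qed simp
    \<comment> \<open>Since \<open>?x = 2 * (1 - 1 / (2 * s))\<close>, Bernoulli shows that growth
      over \<open>s - 1\<close> levels keeps at least half of the full factor
      \<open>2 ^ (s - 1)\<close>.\<close>
    have "1 - real (s - 1) / (2 * real s) \<le> (1 - 1 / (2 * real s)) ^ (s - 1)"
      using Bernoulli_inequality[of "- (1 / (2 * real s))" "s - 1"] s by (simp add: divide_simps)
    moreover have "1 / 2 \<le> 1 - real (s - 1) / (2 * real s)"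
      using s by (simp add: field_simps)
    ultimately have "2 ^ (s - 1) * (1 / 2) \<le> 2 ^ (s - 1) * (1 - 1 / (2 * real s)) ^ (s - 1)"
      by (intro mult_left_mono) auto
    also have "\<dots> = ?x ^ (s - 1)"
      by (simp add: algebra_simps flip: power_mult_distrib)
    finally have "2 ^ (s - 1) * (1 / 2) * ?g k \<le> ?x ^ (s - 1) * ?g k"
      by (intro mult_right_mono) auto
    also have "\<dots> \<le> ?g t" using pow[of "s - 1"] tk by simp
    finally have gk: "2 ^ s * ?g k \<le> 4 * ?g t"
      using s by (cases s) (simp_all add: mult_ac)
    let ?B = "\<lambda>A. {a. a div 2 ^ s = A \<and> bad (k + s) a}"
    \<comment> \<open>\<open>?D\<close> takes all bad descendants, whether or not the cells in
      between survive, so that \<open>few\<close> applies to each \<open>A\<close>.\<close>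
    let ?D = "\<Union>A\<in>survivors bad k. ?B A"
    have finD: "finite ?D" using fin finite_survivors by blast
    have "real (card ?D) \<le> ?g k * (2 ^ s / (4 * real s))"
      by (rule card_UN_le_times[OF finite_survivors few])
    also have "\<dots> \<le> ?g t / real s"
      using gk s by (simp add: field_simps)
    finally have D: "real (card ?D) \<le> ?g t / real s" .
    have "{a. a div 2 \<in> survivors bad t} \<subseteq> survivors bad (Suc t) \<union> ?D"
    proof
      fix a assume a: "a \<in> {a. a div 2 \<in> survivors bad t}"
      show "a \<in> survivors bad (Suc t) \<union> ?D"
      proof (cases "bad (k + s) a")
        case True
        have "a div 2 div 2 ^ (s - 1) \<in> survivors bad k"
          using a tk by (intro survivors_ancestor) simp
        moreover have "a div 2 div 2 ^ (s - 1) = a div 2 ^ s"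
          using s by (cases s) (simp_all add: zdiv_zmult2_eq)
        ultimately show ?thesis using True by simp
      next
        case False
        then have "\<not> bad (Suc t) a" unfolding k .
        then have "a \<in> survivors bad (Suc t)" using a by simp
        then show ?thesis ..
      qed
    qed
    then have "card {a. a div 2 \<in> survivors bad t} \<le> card (survivors bad (Suc t)) + card ?D"
      using card_mono[of "survivors bad (Suc t) \<union> ?D"] card_Un_le[of "survivors bad (Suc t)" ?D]
        finD finite_survivors[of bad "Suc t"] by (meson finite_UnI le_trans)
    then have "2 * ?g t \<le> ?g (Suc t) + real (card ?D)" using ch by linarith
    then show ?thesis using D by (simp add: algebra_simps)
  qed
qed

lemma survivors_nonempty:
  assumes "s \<ge> 1"
    and "\<And>t a. bad t a \<Longrightarrow> s \<le> t"
    and "\<And>k A. finite {a. a div 2 ^ s = A \<and> bad (k + s) a}"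
    and "\<And>k A. real (card {a. a div 2 ^ s = A \<and> bad (k + s) a}) \<le> 2 ^ s / (4 * real s)"
  shows "survivors bad t \<noteq> {}"
proof -
  have "card (survivors bad t) > 0"
  proof (induction t)
    case (Suc t)
    have "0 < (2 - 1 / real s) * real (card (survivors bad t))"
      using Suc assms(1) by (intro mult_pos_pos) (auto simp: field_simps)
    also have "\<dots> \<le> real (card (survivors bad (Suc t)))"
      using assms by (rule survivors_growth)
    finally show ?case by simp
  qed simp
  then show ?thesis by auto
qed

section \<open>Counting the cells deleted by one number\<close>

lemma ints_in_open_interval:
  fixes p q :: real
  assumes "p \<le> q + 1"
  shows "finite {m::int. p < m \<and> m < q}"
    and "real (card {m::int. p < m \<and> m < q}) \<le> q - p + 1"
proof -
  have eq: "{m::int. p < m \<and> m < q} = {\<lfloor>p\<rfloor> + 1..\<lceil>q\<rceil> - 1}"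
    by (auto simp: floor_less_iff less_ceiling_iff) linarith+
  show "finite {m::int. p < m \<and> m < q}" by (simp add: eq)
  have "real (card {\<lfloor>p\<rfloor> + 1..\<lceil>q\<rceil> - 1}) = real (nat (\<lceil>q\<rceil> - 1 - \<lfloor>p\<rfloor>))" by simp
  also have "\<dots> \<le> q - p + 1"
    \<comment> \<open>If the difference is negative, \<open>nat\<close> returns 0, and the
      assumption makes the bound nonnegative.\<close>
    using assms by (cases "\<lceil>q\<rceil> - 1 - \<lfloor>p\<rfloor> \<ge> 0") (simp_all, linarith+)
  finally show "real (card {m::int. p < m \<and> m < q}) \<le> q - p + 1" by (simp add: eq)
qed

text \<open>For \<open>\<beta> = v * 4 / 2^t\<close>, multiplication by \<open>v\<close> maps cell
  \<open>a\<close> of level \<open>t\<close> onto \<open>[\<beta> * a, \<beta> * (a + 1)]\<close>;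
  the condition asks for an integer at distance less than \<delta> from this image.\<close>

definition meets_bad :: "real \<Rightarrow> real \<Rightarrow> int \<Rightarrow> bool" where
  "meets_bad \<delta> \<beta> a \<longleftrightarrow> (\<exists>m::int. \<beta> * a - \<delta> < m \<and> m < \<beta> * (a + 1) + \<delta>)"

lemma int_div_cell_bounds:
  fixes N a :: int
  assumes "N > 0"
  shows "a div N * N \<le> a" and "a + 1 \<le> (a div N + 1) * N"
proof -
  have "a = a div N * N + a mod N" by (rule div_mult_mod_eq[symmetric])
  moreover have "0 \<le> a mod N" "a mod N < N" using assms by simp_all
  ultimately show "a div N * N \<le> a" and "a + 1 \<le> (a div N + 1) * N"
    unfolding distrib_right mult_1_left by linarith+
qed

text \<open>The image of the ancestor \<open>A\<close>, widened by \<delta> on both sides, contains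
  at most \<open>\<beta> * N + 2 * \<delta> + 1\<close> integers, and each of them spoils at most
  \<open>2 * \<delta> / \<beta> + 2\<close> cells.\<close>

lemma card_meets_bad:
  fixes \<beta> \<delta> :: real and N :: int
  assumes \<beta>: "\<beta> > 0" and \<delta>: "\<delta> > 0" and N: "N > 0"
  shows "finite {a. a div N = A \<and> meets_bad \<delta> \<beta> a}"
    and "real (card {a. a div N = A \<and> meets_bad \<delta> \<beta> a})
      \<le> (\<beta> * N + 2 * \<delta> + 1) * (2 * \<delta> / \<beta> + 2)"
proof -
  let ?S = "{a. a div N = A \<and> meets_bad \<delta> \<beta> a}"
  define lo hi where "lo = \<beta> * (A * N) - \<delta>" and "hi = \<beta> * ((A + 1) * N) + \<delta>"
  define Ms where "Ms = {m::int. lo < m \<and> m < hi}"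
  define C where "C m = {a::int. (m - \<delta>) / \<beta> - 1 < a \<and> a < (m + \<delta>) / \<beta>}" for m :: int
  have hilo: "hi - lo = \<beta> * N + 2 * \<delta>" by (simp add: hi_def lo_def algebra_simps)
  have bN: "\<beta> * N > 0" using \<beta> N by simp
  have "lo \<le> hi + 1" using hilo bN \<delta> by linarith
  note Ms = ints_in_open_interval[OF this, folded Ms_def]
  have d: "(m + \<delta>) / \<beta> - ((m - \<delta>) / \<beta> - 1) = 2 * \<delta> / \<beta> + 1" for m :: real
    using \<beta> by (simp add: field_simps)
  have "2 * \<delta> / \<beta> > 0" using \<beta> \<delta> by simp
  then have "(m - \<delta>) / \<beta> - 1 \<le> (m + \<delta>) / \<beta> + 1" for m :: real
    using d[of m] by linarith
  note C = ints_in_open_interval[OF this, folded C_def]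
  have C2: "real (card (C m)) \<le> 2 * \<delta> / \<beta> + 2" for m
    using C(2)[of m] d[of m] by (simp add: C_def)
  have sub: "?S \<subseteq> (\<Union>m\<in>Ms. C m)"
  proof
    fix a assume a: "a \<in> ?S"
    then obtain m :: int where m: "\<beta> * a - \<delta> < m" "m < \<beta> * (a + 1) + \<delta>"
      by (auto simp: meets_bad_def)
    have "A * N \<le> a" "a + 1 \<le> (A + 1) * N"
      using int_div_cell_bounds[OF N, of a] a by simp_all
    then have "real_of_int (A * N) \<le> a" "real_of_int (a + 1) \<le> real_of_int ((A + 1) * N)"
      by (simp_all only: of_int_le_iff)
    then have "\<beta> * (A * N) \<le> \<beta> * a" "\<beta> * (a + 1) \<le> \<beta> * ((A + 1) * N)"
      using \<beta> by (simp_all)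
    then have "m \<in> Ms" using m by (simp add: Ms_def lo_def hi_def)
    moreover have "a \<in> C m" using m \<beta> by (simp add: C_def field_simps)
    ultimately show "a \<in> (\<Union>m\<in>Ms. C m)" by blast
  qed
  have fin: "finite (\<Union>m\<in>Ms. C m)" using Ms(1) C(1) by (simp add: C_def)
  then show "finite ?S" using sub finite_subset by blast
  have "real (card ?S) \<le> real (card (\<Union>m\<in>Ms. C m))"
    using card_mono[OF fin sub] by simp
  also have "\<dots> \<le> real (card Ms) * (2 * \<delta> / \<beta> + 2)"
    by (rule card_UN_le_times[OF Ms(1) C2])
  also have "\<dots> \<le> (\<beta> * N + 2 * \<delta> + 1) * (2 * \<delta> / \<beta> + 2)"
    using Ms(2) hilo \<beta> \<delta> by (intro mult_right_mono) auto
  finally show "real (card ?S) \<le> (\<beta> * N + 2 * \<delta> + 1) * (2 * \<delta> / \<beta> + 2)" .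
qed

text \<open>The factor \<open>4\<close> in \<open>\<beta>\<close> is the length of the root cell \<open>[0, 4)\<close>.\<close>

lemma card_meets_bad_scale:
  fixes \<delta> :: real and v s k :: nat
  defines "\<beta> \<equiv> real v * 4 / 2 ^ (k + s)"
  assumes v: "2 ^ k \<le> v" "v < 2 ^ Suc k" and \<delta>: "0 < \<delta>" "\<delta> \<le> 1 / 4" "4 \<le> \<delta> * 2 ^ s"
  shows "finite {a. a div 2 ^ s = A \<and> meets_bad \<delta> \<beta> a}"
    and "real (card {a. a div 2 ^ s = A \<and> meets_bad \<delta> \<beta> a}) \<le> 15 / 2 * \<delta> * 2 ^ s"
proof -
  \<comment> \<open>Dividing by the scale puts \<open>y\<close> in \<open>[1, 2]\<close>, which
    makes the bound independent of \<open>k\<close>.\<close>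
  define y where "y = real v / 2 ^ k"
  have "real (2 ^ k) \<le> real v" "real v \<le> real (2 ^ Suc k)"
    using v by (simp_all only: of_nat_le_iff)
  then have y: "1 \<le> y" "y \<le> 2" by (simp_all add: y_def field_simps)
  have \<beta>: "\<beta> = 4 * y / 2 ^ s" by (simp add: \<beta>_def y_def power_add)
  then have "\<beta> > 0" using y by simp
  note card_meets_bad[OF this \<delta>(1), of "2 ^ s" A]
  then show "finite {a. a div 2 ^ s = A \<and> meets_bad \<delta> \<beta> a}" by simp
  define X where "X = \<delta> * 2 ^ s"
  have X: "X \<ge> 4" using \<delta> by (simp add: X_def)
  have "real (card {a. a div 2 ^ s = A \<and> meets_bad \<delta> \<beta> a})
      \<le> (\<beta> * 2 ^ s + 2 * \<delta> + 1) * (2 * \<delta> / \<beta> + 2)"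
    using card_meets_bad(2)[OF \<open>\<beta> > 0\<close> \<delta>(1), of "2 ^ s" A] by simp
  also have "\<dots> = (4 * y + (2 * \<delta> + 1)) * (X / (2 * y) + 2)"
    using y by (simp add: \<beta> X_def field_simps)
  also have "\<dots> = 2 * X + 8 * y + (2 * \<delta> + 1) * (X / (2 * y) + 2)"
    using y by (simp add: field_simps)
  also have "\<dots> \<le> 2 * X + 16 + 3 / 2 * (X / 2 + 2)"
    using y X \<delta> by (intro add_mono mult_mono) (auto simp: field_simps)
  \<comment> \<open>The left side is \<open>11/4 * X + 19\<close>, and
    \<open>19 \<le> 19/4 * X\<close> is exactly \<open>X \<ge> 4\<close>.\<close>
  also have "\<dots> \<le> 15 / 2 * X" using X by (simp add: field_simps)
  finally show "real (card {a. a div 2 ^ s = A \<and> meets_bad \<delta> \<beta> a}) \<le> 15 / 2 * \<delta> * 2 ^ s"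
    by (simp add: X_def)
qed

section \<open>From surviving cells to a point\<close>

text \<open>The left endpoint of a survivor at level \<open>K + s\<close> works: a number of scale
  \<open>k < K\<close> was tested on the ancestor at level \<open>k + s\<close>, which contains that
  endpoint.\<close>

lemma avoid_finitely_many:
  fixes n :: "nat \<Rightarrow> nat" and M s K :: nat and \<delta> :: real
  assumes scale_fin: "\<And>k. finite {j\<in>J. 2 ^ k \<le> n j \<and> n j < 2 ^ Suc k}"
    and scale_card: "\<And>k. card {j\<in>J. 2 ^ k \<le> n j \<and> n j < 2 ^ Suc k} \<le> M"
    and pos: "\<And>j. j \<in> J \<Longrightarrow> n j > 0"
    and s: "s \<ge> 1"
    and \<delta>: "0 < \<delta>" "\<delta> \<le> 1 / 4" "4 \<le> \<delta> * 2 ^ s" "30 * real M * real s * \<delta> \<le> 1"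
  shows "\<exists>\<theta>\<in>{0..4}. \<forall>j\<in>J. n j < 2 ^ K \<longrightarrow> (\<forall>m::int. \<delta> \<le> \<bar>real (n j) * \<theta> - m\<bar>)"
proof -
  define I where "I k = {j\<in>J. 2 ^ k \<le> n j \<and> n j < 2 ^ Suc k}" for k
  \<comment> \<open>The guard \<open>s \<le> t\<close> stops truncated subtraction from assigning
    scale 0 to the levels below \<open>s\<close>.\<close>
  define bad where
    "bad t a \<longleftrightarrow> s \<le> t \<and> (\<exists>j\<in>I (t - s). meets_bad \<delta> (real (n j) * 4 / 2 ^ t) a)" for t a
  have bad_eq: "{a. a div 2 ^ s = A \<and> bad (k + s) a}
      = (\<Union>j\<in>I k. {a. a div 2 ^ s = A \<and> meets_bad \<delta> (real (n j) * 4 / 2 ^ (k + s)) a})"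
    (is "_ = (\<Union>j\<in>_. ?S j)") for k A
    by (auto simp: bad_def)
  have fin: "finite {a. a div 2 ^ s = A \<and> bad (k + s) a}" for k A
    unfolding bad_eq using scale_fin card_meets_bad_scale(1)[OF _ _ \<delta>(1-3)]
    by (auto simp: I_def)
  have few: "real (card {a. a div 2 ^ s = A \<and> bad (k + s) a}) \<le> 2 ^ s / (4 * real s)" for k A
  proof -
    let ?S = "\<lambda>j. {a. a div 2 ^ s = A \<and> meets_bad \<delta> (real (n j) * 4 / 2 ^ (k + s)) a}"
    have "real (card (\<Union>j\<in>I k. ?S j)) \<le> real (card (I k)) * (15 / 2 * \<delta> * 2 ^ s)"
      using scale_fin card_meets_bad_scale(2)[OF _ _ \<delta>(1-3)]
      by (intro card_UN_le_times) (auto simp: I_def)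
    also have "\<dots> \<le> real M * (15 / 2 * \<delta> * 2 ^ s)"
      using scale_card[of k] \<delta> by (intro mult_right_mono) (auto simp: I_def)
    \<comment> \<open>The constant 30 is \<open>4 * (15/2)\<close>, matching the budget
      \<open>2^s / (4 * s)\<close>.\<close>
    also have "\<dots> = (30 * real M * real s * \<delta>) * (2 ^ s / (4 * real s))"
      using s by (simp add: field_simps)
    also have "\<dots> \<le> 1 * (2 ^ s / (4 * real s))"
      using \<delta>(4) by (intro mult_right_mono) auto
    finally show ?thesis unfolding bad_eq by simp
  qed
  have "survivors bad (K + s) \<noteq> {}"
    using s _ fin few by (rule survivors_nonempty) (simp add: bad_def)
  then obtain a where a: "a \<in> survivors bad (K + s)" by blast
  define \<theta> where "\<theta> = 4 * real_of_int a / 2 ^ (K + s)"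
  have "0 \<le> a \<and> a < 2 ^ (K + s)" using a by (rule survivors_bounds)
  then have "0 \<le> a" "real_of_int a \<le> real_of_int (2 ^ (K + s))"
    by (simp, simp only: of_int_le_iff, simp)
  then have "\<theta> \<in> {0..4}" by (simp add: \<theta>_def divide_simps)
  moreover have "\<delta> \<le> \<bar>real (n j) * \<theta> - m\<bar>" if j: "j \<in> J" "n j < 2 ^ K" for j and m :: int
  proof (rule ccontr)
    assume close: "\<not> \<delta> \<le> \<bar>real (n j) * \<theta> - m\<bar>"
    have "1 \<le> n j" using pos[OF j(1)] by simp
    then obtain k where k: "2 ^ k \<le> n j" "n j < 2 ^ Suc k"
      using ex_power_ivl1[of 2 "n j"] by auto
    then have "k < K" using j(2)
      by (meson le_less_trans nat_power_less_imp_less zero_less_numeral)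
    define i where "i = K - k"
    have Ki: "K + s = (k + s) + i" using \<open>k < K\<close> by (simp add: i_def)
    define b where "b = a div 2 ^ i"
    have "b \<in> survivors bad (k + s)"
      unfolding b_def using a Ki by (intro survivors_ancestor) simp
    \<comment> \<open>The level is positive, so \<open>b\<close> has passed a test; the root never
      undergoes one.\<close>
    moreover obtain t where "k + s = Suc t" using s by (metis add_eq_0_iff_both_eq_0 not0_implies_Suc not_one_le_zero)
    ultimately have "\<not> bad (k + s) b" by simp
    then have nm: "\<not> meets_bad \<delta> (real (n j) * 4 / 2 ^ (k + s)) b"
      using j k by (simp add: bad_def I_def)
    have "b * 2 ^ i \<le> a" "a + 1 \<le> (b + 1) * 2 ^ i"
      using int_div_cell_bounds[of "2 ^ i" a] by (simp_all add: b_def)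
    then have "real_of_int (b * 2 ^ i) \<le> a" "a \<le> real_of_int ((b + 1) * 2 ^ i)"
      unfolding of_int_le_iff by linarith+
    then have "b * 4 / 2 ^ (k + s) \<le> \<theta>" "\<theta> \<le> (b + 1) * 4 / 2 ^ (k + s)"
      by (simp_all add: \<theta>_def Ki power_add divide_simps, simp_all add: algebra_simps)
    then have "real (n j) * (b * 4 / 2 ^ (k + s)) \<le> real (n j) * \<theta>"
      "real (n j) * \<theta> \<le> real (n j) * ((b + 1) * 4 / 2 ^ (k + s))"
      by - (rule mult_left_mono, assumption, simp)+
    then have "meets_bad \<delta> (real (n j) * 4 / 2 ^ (k + s)) b"
      using close unfolding meets_bad_def by (intro exI[of _ m]) (auto simp: abs_if mult_ac split: if_splits)
    then show False using nm by contradiction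
  qed
  ultimately show ?thesis by blast
qed

text \<open>Compactness of \<open>[0, 4]\<close>: the sets of points good for all
  \<open>n j < 2^K\<close> are closed and shrink as \<open>K\<close> grows, so a finite subfamily is
  handled by its largest index.\<close>

lemma avoid_all:
  fixes n :: "nat \<Rightarrow> nat" and M s :: nat and \<delta> :: real
  assumes "\<And>k. finite {j\<in>J. 2 ^ k \<le> n j \<and> n j < 2 ^ Suc k}"
    and "\<And>k. card {j\<in>J. 2 ^ k \<le> n j \<and> n j < 2 ^ Suc k} \<le> M"
    and "\<And>j. j \<in> J \<Longrightarrow> n j > 0"
    and "s \<ge> 1"
    and "0 < \<delta>" "\<delta> \<le> 1 / 4" "4 \<le> \<delta> * 2 ^ s" "30 * real M * real s * \<delta> \<le> 1"
  shows "\<exists>\<theta>. \<forall>j\<in>J. \<forall>m::int. \<delta> \<le> \<bar>real (n j) * \<theta> - m\<bar>"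
proof -
  define F where "F K = (\<Inter>j\<in>{j\<in>J. n j < 2 ^ K}. \<Inter>m::int. {\<theta>. \<delta> \<le> \<bar>real (n j) * \<theta> - m\<bar>})" for K :: nat
  have "{0..4} \<inter> (\<Inter>K. F K) \<noteq> {}"
  proof (rule compact_imp_fip_image)
    show "compact {0..4::real}" by simp
    show "closed (F K)" for K
      unfolding F_def by (intro closed_INT ballI closed_Collect_le continuous_intros)
    fix Ks :: "nat set" assume Ks: "finite Ks"
    \<comment> \<open>\<open>insert 0\<close> keeps \<open>Max\<close> meaningful when
      \<open>Ks\<close> is empty.\<close>
    obtain \<theta> where \<theta>: "\<theta> \<in> {0..4}"
      "\<forall>j\<in>J. n j < 2 ^ Max (insert 0 Ks) \<longrightarrow> (\<forall>m::int. \<delta> \<le> \<bar>real (n j) * \<theta> - m\<bar>)"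
      using avoid_finitely_many[OF assms, of "Max (insert 0 Ks)"] by blast
    have "\<theta> \<in> F K" if "K \<in> Ks" for K
    proof -
      have "(2::nat) ^ K \<le> 2 ^ Max (insert 0 Ks)"
        using that Ks by (intro power_increasing Max_ge) auto
      then show ?thesis using \<theta>(2) unfolding F_def by (blast intro: less_le_trans)
    qed
    then show "{0..4} \<inter> (\<Inter>K\<in>Ks. F K) \<noteq> {}" using \<theta>(1) by blast
  qed
  then obtain \<theta> where \<theta>: "\<And>K. \<theta> \<in> F K" by blast
  \<comment> \<open>The index \<open>K = n j\<close> suffices because
    \<open>n j < 2 ^ n j\<close>.\<close>
  have "\<delta> \<le> \<bar>real (n j) * \<theta> - m\<bar>" if "j \<in> J" for j and m :: int
    using \<theta>[of "n j"] that less_exp[of "n j"] unfolding F_def by blast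
  then show ?thesis by blast
qed

section \<open>Lacunarity and the choice of constants\<close>

lemma lacunary_iterate:
  fixes n :: "nat \<Rightarrow> nat"
  assumes "\<And>j. j \<ge> 1 \<Longrightarrow> n (j + M) > 2 * n j" and "j \<ge> 1" and "i \<ge> 1"
  shows "n (j + i * M) > 2 * n j"
  using \<open>i \<ge> 1\<close>
proof (induction i rule: nat_induct_at_least)
  case base
  then show ?case using assms by simp
next
  case (Suc i)
  have "n (j + i * M + M) > 2 * n (j + i * M)" using assms by simp
  then have "n (j + i * M + M) > 2 * n j" using Suc.IH by linarith
  then show ?case by (simp add: algebra_simps)
qed

text \<open>Indices congruent modulo \<open>M\<close> have values more than a factor 2 apart, too
  far for one scale, so each residue class contributes at most one index.\<close>

lemma card_scale:
  fixes n :: "nat \<Rightarrow> nat" and M k :: nat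
  assumes M: "M > 0" and lac: "\<And>j. j \<ge> 1 \<Longrightarrow> n (j + M) > 2 * n j"
  defines "I \<equiv> {j\<in>{1..}. 2 ^ k \<le> n j \<and> n j < 2 ^ Suc k}"
  shows "finite I" and "card I \<le> M"
proof -
  have ne: "i mod M \<noteq> j mod M" if "i \<in> I" "j \<in> I" "i < j" for i j
  proof
    assume "i mod M = j mod M"
    then obtain q where q: "j - i = M * q"
      using mod_eq_dvd_iff_nat[of i j M] \<open>i < j\<close> by (metis dvdE less_imp_le)
    then have "j = i + q * M" "q \<ge> 1" using \<open>i < j\<close> by (auto simp: algebra_simps Suc_le_eq intro!: gr0I)
    then have "n j > 2 * n i" using lacunary_iterate[of n M i q, OF lac] \<open>i \<in> I\<close> by (simp add: I_def)
    then show False using that by (simp add: I_def)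
  qed
  have inj: "inj_on (\<lambda>j. j mod M) I"
    by (rule inj_onI) (metis ne linorder_neqE_nat)
  have sub: "(\<lambda>j. j mod M) ` I \<subseteq> {..<M}" using M by auto
  show "finite I" using inj_on_finite[OF inj sub] by simp
  show "card I \<le> M" using card_inj_on_le[OF inj sub] by simp
qed

text \<open>The witness is the integer part of \<open>8 * log 2 M\<close>. The last property becomes
  \<open>4 \<le> \<delta> * 2^s\<close> once \<open>\<delta> = 1 / (30 * M * s)\<close>.\<close>

lemma depth_exists:
  fixes M :: nat
  assumes "M \<ge> 4"
  obtains s :: nat where "s \<ge> 1" "real s \<le> 8 * log 2 (real M)" "120 * M * s \<le> 2 ^ s"
proof -
  obtain s where s: "2 ^ s \<le> M ^ 8" "M ^ 8 < 2 ^ (s + 1)"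
    using ex_power_ivl1[of 2 "M ^ 8"] assms by auto
  have M6: "4096 \<le> M ^ 6" using power_mono[OF assms, of 6] by simp
  have M8: "M ^ 8 = M ^ 6 * (M * M)" by (simp add: eval_nat_numeral)
  have M2: "4 * 4 \<le> M * M" using assms by (intro mult_mono) auto
  have big: "4096 * (M * M) \<le> M ^ 8" unfolding M8 using M6 by (intro mult_right_mono) auto
  have "s \<ge> 1" using s big M2 by (cases s) auto
  moreover have "real s \<le> 8 * log 2 (real M)"
  proof -
    have "real (2 ^ s) \<le> real (M ^ 8)" using s(1) by (simp only: of_nat_le_iff)
    then have "real s \<le> log 2 (real M ^ 8)" using assms by (simp add: le_log_iff powr_realpow)
    then show ?thesis using assms by (simp add: log_nat_power)
  qed
  \<comment> \<open>From \<open>M < 2^M\<close> follows \<open>s \<le> 8 * M\<close>, so the left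
    side is at most \<open>960 * M^2\<close>, while
    \<open>2^s > M^8 / 2 \<ge> 2048 * M^2\<close>.\<close>
  moreover have "120 * M * s \<le> 2 ^ s"
  proof -
    have "M ^ 8 \<le> (2 ^ M) ^ 8" using less_exp[of M] by (intro power_mono) auto
    then have "(2::nat) ^ s \<le> 2 ^ (M * 8)" unfolding power_mult using s(1) by linarith
    then have "s \<le> M * 8" by (simp only: power_increasing_iff one_less_numeral_iff semiring_norm)
    then have "M * s \<le> M * (M * 8)" by (rule mult_left_mono) simp
    then have "120 * M * s \<le> 960 * (M * M)" by (simp add: algebra_simps)
    then show ?thesis using big s(2) unfolding power_add power_one_right by linarith
  qed
  ultimately show thesis by (rule that)
qed

theorem theorem3p1:
  fixes M :: nat and n :: "nat \<Rightarrow> nat" and c\<^sub>0 :: real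
  assumes "M \<ge> 4"
    and "\<And>j. j \<ge> 1 \<Longrightarrow> n j > 0"
    and "\<And>j. j \<ge> 1 \<Longrightarrow> n (j + M) > 2 * n j"
    and "240 * c\<^sub>0 \<le> 1"
  shows "(\<Inter>j\<in>{1..}. circle - E M c\<^sub>0 n j) \<noteq> {}"
proof -
  obtain s where s: "s \<ge> 1" "real s \<le> 8 * log 2 (real M)" "120 * M * s \<le> 2 ^ s"
    using depth_exists[OF assms(1)] .
  define \<delta> where "\<delta> = 1 / (30 * real M * real s)"
  have Ms: "4 * 1 \<le> real M * real s" using assms(1) s(1) by (intro mult_mono) auto
  have "real (120 * M * s) \<le> real (2 ^ s)" using s(3) by (simp only: of_nat_le_iff)
  then have \<delta>: "0 < \<delta>" "\<delta> \<le> 1 / 4" "4 \<le> \<delta> * 2 ^ s" "30 * real M * real s * \<delta> \<le> 1"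
    using Ms assms(1) s(1) by (simp_all add: \<delta>_def divide_simps)
  have "M > 0" using assms(1) by simp
  note scale = card_scale[of M n, OF this assms(3)]
  obtain \<theta> where \<theta>: "\<And>j m. j \<in> {1..} \<Longrightarrow> \<delta> \<le> \<bar>real (n j) * \<theta> - of_int m\<bar>"
    using avoid_all[OF scale(1) scale(2) _ s(1) \<delta>] assms(2) by (metis atLeast_iff)
  \<comment> \<open>Here \<open>240 = 30 * 8\<close> arises, from
    \<open>\<delta> = 1 / (30 * M * s)\<close> and \<open>s \<le> 8 * log 2 M\<close>.\<close>
  have c: "c\<^sub>0 / (real M * log 2 (real M)) \<le> \<delta>"
  proof -
    have L: "log 2 (real M) > 0" using assms(1) by simp
    have "c\<^sub>0 / (real M * log 2 (real M)) \<le> (1 / 240) / (real M * log 2 (real M))"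
      using assms(4) L by (intro divide_right_mono) auto
    also have "\<dots> = 1 / (30 * real M * (8 * log 2 (real M)))" by simp
    also have "\<dots> \<le> \<delta>" unfolding \<delta>_def
      using s(1,2) assms(1) L by (intro divide_left_mono mult_left_mono mult_pos_pos) auto
    finally show ?thesis .
  qed
  have "frac \<theta> \<in> circle - E M c\<^sub>0 n j" if j: "j \<in> {1..}" for j
  proof -
    \<comment> \<open>Passing to \<open>frac \<theta>\<close> shifts the product by the integer
      \<open>int (n j) * \<lfloor>\<theta>\<rfloor>\<close>, which the arbitrary integer
      \<open>m\<close> in the bound for \<theta> absorbs.\<close>
    have "real (n j) * frac \<theta> - of_int (round (real (n j) * frac \<theta>))
        = real (n j) * \<theta> - of_int (int (n j) * \<lfloor>\<theta>\<rfloor> + round (real (n j) * frac \<theta>))"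
      by (simp add: frac_def algebra_simps)
    then have "\<delta> \<le> dist_nearest_int (real (n j) * frac \<theta>)"
      unfolding dist_nearest_int_def dist_real_def using \<theta>[OF j] by metis
    then show ?thesis using c by (simp add: circle_def E_def frac_ge_0 frac_lt_1)
  qed
  then show ?thesis by blast
qed

end
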